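(* Let $(M,d)$ be an ultrametric space and let $A,B\subseteq M$ be nonempty spherically complete subsets. Assume that $B$ is bounded and $\delta(B)\le\mathrm{dist}(A,B)$. Then $A_0$ and $B_0$ are both nonempty and spherically complete.
   Context: An ultrametric space is a metric space $(M,d)$ with $d(x,y)\le\max\{d(x,z),d(z,y)\}$ for all $x,y,z\in M$. Closed balls are $B(x,r)=\{y: d(x,y)\le r\}$. An ultrametric space is spherically complete if each nested sequence of (closed) balls $B_1\supseteq B_2\supseteq\cdots$ has nonempty intersection; a subset of $M$ is spherically complete if it is so as a subspace with the induced metric. For a bounded set $B$, $\delta(B)=\sup\{d(x,y): x,y\in B\}$. For nonempty $A,B\subseteq M$, $\mathrm{dist}(A,B)=\inf\{d(a,b): a\in A,\ b\in B\}$, and $$A_0=\{x\in A: d(x,y)=\mathrm{dist}(A,B)\text{ for some }y\in B\},\qquad B_0=\{y\in B: d(x,y)=\mathrm{dist}(A,B)\text{ for some }x\in A\}.$$ A property is attributed to a pair $(A,B)$ when both $A$ and $B$ have it. *)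

theory Defs
  imports "HOL-Analysis.Abstract_Metric_Spaces"
begin

locale Ultrametric_space = Metric_space +
  assumes ultrametric:
    "\<And>x y z. \<lbrakk>x \<in> M; y \<in> M; z \<in> M\<rbrakk> \<Longrightarrow> d x y \<le> max (d x z) (d z y)"

text \<open>
  Spherical completeness of the space with carrier \<open>S\<close> and metric \<open>d\<close> restricted to \<open>S\<close>:
  the balls are those of the subspace \<open>S\<close>, with centre in \<open>S\<close>. The radius is required to be
  nonnegative because \<open>mcball\<close> is empty for a negative radius.
\<close>

definition spherically_complete :: "'a set \<Rightarrow> ('a \<Rightarrow> 'a \<Rightarrow> real) \<Rightarrow> bool" where
  "spherically_complete S d \<longleftrightarrow>
     (\<forall>C :: nat \<Rightarrow> 'a set.
        (\<forall>n. \<exists>x\<in>S. \<exists>r\<ge>0. C n = Metric_space.mcball S d x r) \<and> decseq C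
        \<longrightarrow> (\<Inter>n. C n) \<noteq> {})"

definition set_diam :: "('a \<Rightarrow> 'a \<Rightarrow> real) \<Rightarrow> 'a set \<Rightarrow> real" where
  "set_diam d B = Sup {d x y | x y. x \<in> B \<and> y \<in> B}"

definition set_dist :: "('a \<Rightarrow> 'a \<Rightarrow> real) \<Rightarrow> 'a set \<Rightarrow> 'a set \<Rightarrow> real" where
  "set_dist d A B = Inf {d a b | a b. a \<in> A \<and> b \<in> B}"

text \<open>\<open>A\<^sub>0\<close> and \<open>B\<^sub>0\<close> for a pair \<open>(A, B)\<close>.\<close>

definition prox_left :: "('a \<Rightarrow> 'a \<Rightarrow> real) \<Rightarrow> 'a set \<Rightarrow> 'a set \<Rightarrow> 'a set" where
  "prox_left d A B = {x \<in> A. \<exists>y\<in>B. d x y = set_dist d A B}"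

definition prox_right :: "('a \<Rightarrow> 'a \<Rightarrow> real) \<Rightarrow> 'a set \<Rightarrow> 'a set \<Rightarrow> 'a set" where
  "prox_right d A B = {y \<in> B. \<exists>x\<in>A. d x y = set_dist d A B}"

end

theory Submission
  imports Defs
begin

text \<open>
  Since \<open>\<delta>(B) \<le> dist(A, B)\<close>, the ultrametric inequality makes every point of \<open>A\<close> equidistant
  from all points of \<open>B\<close>. Fix \<open>b \<in> B\<close> and put \<open>D = dist(A, B)\<close>. Each set
  \<open>{x \<in> A. d x b \<le> D + 1/n}\<close> is a ball of \<open>A\<close>, and these balls are nested, so spherical
  completeness of \<open>A\<close> yields a point at distance exactly \<open>D\<close> from \<open>b\<close>. Hence \<open>B\<^sub>0 = B\<close>, while
  \<open>A\<^sub>0\<close> is a closed ball of \<open>A\<close> of radius \<open>D\<close>, and closed balls inherit spherical completeness.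
\<close>

context Ultrametric_space
begin

lemma mcball_subspace:
  assumes "S \<subseteq> M"
  shows "Metric_space.mcball S d x r = {y \<in> S. x \<in> S \<and> d x y \<le> r}"
proof -
  interpret S: Metric_space S d
    using assms by (rule subspace)
  show ?thesis
    by (auto simp: S.in_mcball)
qed

text \<open>Two points within \<open>r\<close> of each other are interchangeable as centres of the
  ball of radius \<open>r\<close>: each direction is one ultrametric inequality through the other
  point.\<close>

lemma le_iff_le_of_le:
  assumes "x \<in> M" "y \<in> M" "z \<in> M" "d x y \<le> r"
  shows "d x z \<le> r \<longleftrightarrow> d y z \<le> r"
  using ultrametric[of x z y] ultrametric[of y z x] commute[of x y] assms by auto

text \<open>The point \<open>b\<close> may lie outside \<open>S\<close>, whereas a ball of
  \<open>S\<close> needs its centre in \<open>S\<close>. Any point of \<open>S\<close> within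
  \<open>r\<close> of \<open>b\<close> can replace \<open>b\<close> as centre.\<close>

lemma mcball_subspace_eq_sublevel:
  assumes "S \<subseteq> M" "x \<in> S" "b \<in> M" "d x b \<le> r"
  shows "Metric_space.mcball S d x r = {y \<in> S. d y b \<le> r}"
proof -
  have "d x y \<le> r \<longleftrightarrow> d y b \<le> r" if "y \<in> S" for y
    using le_iff_le_of_le[of x b y r] commute[of b y] assms that by auto
  then show ?thesis
    using assms by (auto simp: mcball_subspace)
qed

text \<open>Every ball of the subspace \<open>?T\<close> is already a ball of \<open>S\<close>, so a
  nested sequence in \<open>?T\<close> is one in \<open>S\<close>.\<close>

lemma spherically_complete_mcball:
  assumes S: "S \<subseteq> M" and sc: "spherically_complete S d"
  shows "spherically_complete (Metric_space.mcball S d c R) d"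
  unfolding spherically_complete_def
proof (intro allI impI, elim conjE)
  let ?T = "Metric_space.mcball S d c R"
  fix C :: "nat \<Rightarrow> 'a set"
  assume balls: "\<forall>n. \<exists>x\<in>?T. \<exists>r\<ge>0. C n = Metric_space.mcball ?T d x r" and "decseq C"
  have T: "?T \<subseteq> M"
    using S by (auto simp: mcball_subspace)
  have "\<exists>x\<in>S. \<exists>r\<ge>0. C n = Metric_space.mcball S d x r" for n
  proof -
    obtain x r where x: "x \<in> ?T" and r: "r \<ge> 0" and Cn: "C n = Metric_space.mcball ?T d x r"
      using balls by blast
    have xS: "x \<in> S" and cS: "c \<in> S" and cx: "d c x \<le> R"
      using x S by (auto simp: mcball_subspace)
    \<comment> \<open>Recentring \<open>?T\<close> at \<open>x\<close> makes it concentric with the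
      ball of radius \<open>r\<close>, so their intersection \<open>C n\<close> is the ball of the
      smaller radius.\<close>
    have "d c y \<le> R \<longleftrightarrow> d x y \<le> R" if "y \<in> S" for y
      using le_iff_le_of_le[of c x y R] S xS cS cx that by auto
    then have "C n = Metric_space.mcball S d x (min r R)"
      unfolding Cn mcball_subspace[OF T] using S xS cS cx by (auto simp: mcball_subspace)
    moreover have "min r R \<ge> 0"
      using r cx nonneg[of c x] by linarith
    ultimately show ?thesis
      using xS by blast
  qed
  then show "(\<Inter>n. C n) \<noteq> {}"
    using sc \<open>decseq C\<close> unfolding spherically_complete_def by blast
qed

lemma set_dist_le:
  assumes "a \<in> A" "b \<in> B"
  shows "set_dist d A B \<le> d a b"
  unfolding set_dist_def
proof (rule cInf_lower)
  show "bdd_below {d a b | a b. a \<in> A \<and> b \<in> B}"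
    by (rule bdd_belowI[of _ 0]) auto
qed (use assms in blast)

lemma set_dist_less_obtains:
  assumes "A \<noteq> {}" "B \<noteq> {}" "set_dist d A B < r"
  obtains a b where "a \<in> A" "b \<in> B" "d a b < r"
proof -
  have "{d a b | a b. a \<in> A \<and> b \<in> B} \<noteq> {}"
    using assms by blast
  from cInf_lessD[OF this] show thesis
    using assms(3) that unfolding set_dist_def by blast
qed

lemma le_set_diam:
  assumes "mbounded B" "x \<in> B" "y \<in> B"
  shows "d x y \<le> set_diam d B"
  unfolding set_diam_def
proof (rule cSup_upper)
  obtain K where "\<forall>x\<in>B. \<forall>y\<in>B. d x y \<le> K"
    using assms(1) unfolding mbounded_alt by blast
  then show "bdd_above {d x y | x y. x \<in> B \<and> y \<in> B}"
    by (intro bdd_aboveI[of _ K]) blast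
qed (use assms in blast)

text \<open>In the triangle \<open>a\<close>, \<open>u\<close>, \<open>v\<close> the side from
  \<open>v\<close> to \<open>u\<close> is at most the diameter of \<open>B\<close>, hence at most
  \<open>d a v\<close>. The ultrametric inequality then gives \<open>d a u\<close> \<le>
  \<open>d a v\<close>, and \<open>u\<close>, \<open>v\<close> can be swapped.\<close>

lemma equidistant_of_set_diam_le_set_dist:
  assumes "A \<subseteq> M" "B \<subseteq> M" "mbounded B" "set_diam d B \<le> set_dist d A B"
    and "a \<in> A" "b \<in> B" "b' \<in> B"
  shows "d a b = d a b'"
proof -
  have "d a u \<le> d a v" if "u \<in> B" "v \<in> B" for u v
    using ultrametric[of a u v] le_set_diam[of B v u] set_dist_le[of a A v B] assms that
    by fastforce
  then show ?thesis
    using assms by (intro antisym) auto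
qed

lemma ex_dist_eq_set_dist:
  assumes A: "A \<subseteq> M" "A \<noteq> {}" "spherically_complete A d" and B: "B \<subseteq> M" "mbounded B"
    and le: "set_diam d B \<le> set_dist d A B" and b: "b \<in> B"
  shows "\<exists>a\<in>A. d a b = set_dist d A B"
proof -
  define r where "r n = set_dist d A B + 1 / real (Suc n)" for n
  define C where "C n = {x \<in> A. d x b \<le> r n}" for n
  have "\<exists>x\<in>A. \<exists>s\<ge>0. C n = Metric_space.mcball A d x s" for n
  proof -
    \<comment> \<open>The positive slack guarantees a point of \<open>A\<close> to centre the ball
      at, although the infimum is not yet known to be attained.\<close>
    have "set_dist d A B < r n"
      by (simp add: r_def)
    then obtain a b' where a: "a \<in> A" "b' \<in> B" "d a b' < r n"
      using set_dist_less_obtains[of A B] A b by blast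
    \<comment> \<open>The pair found may involve \<open>b'\<close> instead of \<open>b\<close>;
      equidistance carries the bound over to the fixed \<open>b\<close>.\<close>
    then have "d a b \<le> r n"
      using equidistant_of_set_diam_le_set_dist[of A B a b b'] A B le b by simp
    then have "C n = Metric_space.mcball A d a (r n)"
      unfolding C_def using mcball_subspace_eq_sublevel[of A a b] A B b a by blast
    moreover have "r n \<ge> 0"
      using a nonneg[of a b'] by linarith
    ultimately show ?thesis
      using a by blast
  qed
  moreover have "decseq r"
    by (auto simp: r_def decseq_def frac_le)
  then have "decseq C"
    unfolding C_def decseq_def by force
  ultimately have "(\<Inter>n. C n) \<noteq> {}"
    using A(3) unfolding spherically_complete_def by simp
  then obtain a where a: "\<And>n. a \<in> C n"
    by blast
  have "r \<longlonglongrightarrow> set_dist d A B + 0"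
    unfolding r_def using LIMSEQ_inverse_real_of_nat
    by (intro tendsto_add tendsto_const) (simp add: inverse_eq_divide)
  then have "d a b \<le> set_dist d A B"
    by (intro LIMSEQ_le_const[of r]) (use a in \<open>auto simp: C_def\<close>)
  with a show ?thesis
    using set_dist_le[of a A b B] b unfolding C_def by (auto intro: antisym)
qed

end

theorem proposition2p2:
  fixes M :: "'a set" and d :: "'a \<Rightarrow> 'a \<Rightarrow> real" and A B :: "'a set"
  assumes "Ultrametric_space M d"
    and "A \<subseteq> M" and "B \<subseteq> M"
    and "A \<noteq> {}" and "B \<noteq> {}"
    and "spherically_complete A d" and "spherically_complete B d"
    and "Metric_space.mbounded M d B"
    and "set_diam d B \<le> set_dist d A B"
  shows "prox_left d A B \<noteq> {} \<and> prox_right d A B \<noteq> {} \<and>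
    spherically_complete (prox_left d A B) d \<and>
    spherically_complete (prox_right d A B) d"
proof -
  interpret Ultrametric_space M d by fact
  let ?D = "set_dist d A B"
  have near: "\<exists>a\<in>A. d a b = ?D" if "b \<in> B" for b
    using ex_dist_eq_set_dist assms that by blast
  then have right: "prox_right d A B = B"
    by (auto simp: prox_right_def)
  obtain b where b: "b \<in> B"
    using assms by blast
  obtain a where a: "a \<in> A" "d a b = ?D"
    using near b by blast
  \<comment> \<open>Equidistance lets the single point \<open>b\<close> stand for every
    \<open>y\<close> in \<open>B\<close>, and since \<open>?D\<close> is a lower bound, \<le>
    amounts to equality.\<close>
  have "(\<exists>y\<in>B. d x y = ?D) \<longleftrightarrow> d x b \<le> ?D" if "x \<in> A" for x
    using equidistant_of_set_diam_le_set_dist[of A B x b] set_dist_le[of x A b B] assms b that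
    by (metis order_antisym order_refl)
  then have "prox_left d A B = {x \<in> A. d x b \<le> ?D}"
    by (auto simp: prox_left_def)
  also have "\<dots> = Metric_space.mcball A d a ?D"
    using mcball_subspace_eq_sublevel[of A a b ?D] assms a b by auto
  finally have "spherically_complete (prox_left d A B) d"
    using spherically_complete_mcball assms by simp
  moreover have "a \<in> prox_left d A B"
    using a b by (auto simp: prox_left_def)
  ultimately show ?thesis
    using right assms by auto
qed

end
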